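(* For all positive integers $n$, $$\det_{0\leq i,j\le n-1} \left(2^i \binom{i+2j+1}{2j+1} - \binom{i-1}{2j+1}\right) = 2\prod_{i=1}^n \frac{2^{i-1} \, (4i-2)!}{(n+2i-1)!}.$$
   Context: The binomial coefficient is defined, for arbitrary $\alpha$ and integer $p$, by $\binom{\alpha}{p}=\frac{\alpha(\alpha-1)\cdots(\alpha-p+1)}{p!}$ if $p\ge 0$, and $\binom{\alpha}{p}=0$ if $p<0$. (In particular, $\binom{-1}{2j+1}=-1$.) The notation $\det_{0\le i,j\le n-1}(a_{i,j})$ means the determinant of the $n\times n$ matrix with row index $i$ and column index $j$, both running from $0$ to $n-1$. *)

theory Defs
  imports Complex_Main "Jordan_Normal_Form.Determinant"
begin

end

theory Submission
  imports Defs "HOL-Computational_Algebra.Formal_Laurent_Series"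
begin

text \<open>
  Row \<open>i\<close> consists of the odd coefficients of \<open>u\<^sup>-\<^sup>1 ((2/u)\<^sup>i + u\<^sup>i)\<close> with \<open>u = 1 - z\<close>. As \<open>(2/u) \<cdot> u = 2\<close> and
  \<open>2/u + u = w + 3\<close> for \<open>w = z (1 + z) / (1 - z)\<close>, row operations replace it by \<open>w\<^sup>i / (1 - z)\<close>, at the
  cost of a factor 2. The entry in column \<open>j\<close> is a residue at \<open>z = 0\<close> against \<open>z\<^bsup>-2j-2\<^esup>\<close>, and column
  operations replace this monomial by any even series with the same leading term. For
  \<open>m = 2j + 1\<close>, the choice \<open>(z (1 - z\<^sup>2))\<^bsup>-m-1\<^esup> (1 + z\<^sup>2)\<^bsup>2m\<^esup> (1 - 6z\<^sup>2 + z\<^sup>4)\<close>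
  makes the differential equal to \<open>w\<^bsup>i-m-1\<^esup> (1 - w) (1 + w)\<^bsup>2m\<^esup> dw\<close>, so that the entries become the
  ballot numbers \<open>(2i + 1) (2m)! / ((m - i)! (m + i + 1)!)\<close>. Up to row and column factors these are
  values of polynomials of degree below \<open>n\<close> at the points \<open>2, 4, \<dots>, 2n\<close>. Rescaling the points to
  \<open>1, \<dots>, n\<close> costs a power of 2 and makes the matrix triangular.
\<close>

section \<open>Formal residues and change of variable\<close>

text \<open>With \<open>w = fps_X * g\<close>, the coefficient is the residue of
  \<open>w^(p-m-1) dw\<close>. For \<open>p < m\<close> this is the differential of
  \<open>w^(p-m) / (p-m)\<close> and has no residue; for \<open>p = m\<close> it is
  \<open>dw / w\<close>, with residue 1.\<close>

lemma fps_nth_residue_power: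
  fixes g :: "'a::field_char_0 fps"
  assumes g0: "fps_nth g 0 \<noteq> 0" and pm: "p \<le> m"
  shows "fps_nth ((fps_X * g) ^ p * (fps_deriv (fps_X * g) * inverse g ^ Suc m)) m
         = (if p = m then 1 else 0)"
proof -
  define h where "h = inverse g"
  define d where "d = m - p"
  have m: "m = p + d" using pm by (simp add: d_def)
  have gh: "g * h = 1" unfolding h_def by (rule inverse_mult_eq_1'[OF g0])
  have ghp: "g ^ p * h ^ p = 1" by (simp add: gh flip: power_mult_distrib)
  have "(fps_X * g) ^ p * (fps_deriv (fps_X * g) * h ^ Suc m)
        = fps_X ^ p * (g ^ p * h ^ p) * (fps_deriv (fps_X * g) * h ^ Suc d)"
    by (simp add: m power_mult_distrib power_add ac_simps del: fps_deriv_mult)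
  also have "\<dots> = fps_X ^ p * (fps_deriv (fps_X * g) * h ^ Suc d)"
    by (simp only: ghp mult_1_right)
  also have "fps_deriv (fps_X * g) * h ^ Suc d = (g * h) * h ^ d + fps_X * (fps_deriv g * h ^ Suc d)"
    by (simp add: algebra_simps)
  finally have *: "fps_nth ((fps_X * g) ^ p * (fps_deriv (fps_X * g) * h ^ Suc m)) m
      = fps_nth ((g * h) * h ^ d + fps_X * (fps_deriv g * h ^ Suc d)) d"
    by (simp only: fps_X_power_mult_nth m) simp
  note * = *[unfolded gh mult_1]
  show ?thesis
  proof (cases d)
    case 0
    thus ?thesis using * m by (simp add: h_def)
  next
    case (Suc e)
    \<comment> \<open>Coefficient \<open>e\<close> of this derivative is also \<open>d\<close> times
      coefficient \<open>d\<close> of \<open>h ^ d\<close>; cancelling \<open>d\<close> in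
      characteristic 0 gives the vanishing sum.\<close>
    have "fps_deriv (h ^ d) = - (of_nat d * (fps_deriv g * h ^ Suc d))"
      unfolding fps_deriv_power' h_def fps_inverse_deriv[OF g0]
      by (simp add: Suc power2_eq_square ac_simps)
    hence "fps_nth (fps_deriv (h ^ d)) e = - (of_nat d * fps_nth (fps_deriv g * h ^ Suc d) e)"
      by (simp flip: fps_of_nat)
    hence "of_nat d * (fps_nth (h ^ d) d + fps_nth (fps_deriv g * h ^ Suc d) e) = 0"
      by (simp add: Suc distrib_left del: of_nat_Suc power_Suc)
    hence "fps_nth (h ^ d) d + fps_nth (fps_deriv g * h ^ Suc d) e = 0"
      using Suc by (simp del: of_nat_Suc power_Suc)
    thus ?thesis using * m Suc by (simp add: h_def del: power_Suc)
  qed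
qed

text \<open>Residues are invariant under \<open>z \<mapsto> w\<close>: expanding \<open>f\<close> in
  monomials reduces this to the previous lemma, as powers of \<open>w\<close> beyond
  \<open>m\<close> do not reach coefficient \<open>m\<close>.\<close>

lemma fps_nth_residue_compose:
  fixes f g :: "'a::field_char_0 fps"
  assumes g0: "fps_nth g 0 \<noteq> 0"
  shows "fps_nth ((f oo fps_X * g) * (fps_deriv (fps_X * g) * inverse g ^ Suc m)) m = fps_nth f m"
proof -
  define R where "R = fps_deriv (fps_X * g) * inverse g ^ Suc m"
  have low: "fps_nth ((fps_X * g) ^ p) i = 0" if "i < p" for i p
    using that by (simp add: power_mult_distrib fps_X_power_mult_nth)
  have "fps_nth ((f oo fps_X * g) * R) m
      = (\<Sum>i=0..m. (\<Sum>p=0..i. fps_nth f p * fps_nth ((fps_X * g) ^ p) i) * fps_nth R (m - i))"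
    by (simp add: fps_mult_nth fps_compose_nth)
  also have "\<dots> = (\<Sum>i=0..m. (\<Sum>p=0..m. fps_nth f p * fps_nth ((fps_X * g) ^ p) i) * fps_nth R (m - i))"
    by (intro sum.cong refl arg_cong2[where f = "(*)"] sum.mono_neutral_left) (auto simp: low)
  also have "\<dots> = (\<Sum>p=0..m. fps_nth f p * fps_nth ((fps_X * g) ^ p * R) m)"
    unfolding sum_distrib_right fps_mult_nth sum_distrib_left
    by (subst sum.swap) (simp add: mult.assoc)
  also have "\<dots> = (\<Sum>p=0..m. fps_nth f p * (if p = m then 1 else 0))"
    unfolding R_def
    by (intro sum.cong refl arg_cong2[where f = "(*)"] fps_nth_residue_power[OF g0]) simp
  also have "\<dots> = fps_nth f m"
    by (simp add: if_distrib[of "(*) _"] cong: if_cong)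
  finally show ?thesis by (simp only: R_def)
qed

section \<open>Row operations\<close>

text \<open>With \<open>z = fps_X\<close>, the series \<open>w\<close> of the header is \<open>fps_X * w_quot\<close>.\<close>
definition w_quot :: "real fps" where
  "w_quot = (1 + fps_X) * inverse (1 - fps_X)"

text \<open>These are the power sums \<open>a^i + b^i\<close> for \<open>a + b = fps_X + 3\<close>
  and \<open>a * b = 2\<close> (Dickson polynomials), typed as series so that \<open>w\<close> can
  be substituted.\<close>

fun row_poly :: "nat \<Rightarrow> real fps" where
  "row_poly 0 = 2"
| "row_poly (Suc 0) = fps_X + 3"
| "row_poly (Suc (Suc i)) = (fps_X + 3) * row_poly (Suc i) - 2 * row_poly i"

text \<open>The coefficients form the lower triangular matrix of the row operations, whose diagonal
  2, 1, 1, ... accounts for the factor 2.\<close>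

lemma row_poly_nth:
  "k > i \<Longrightarrow> fps_nth (row_poly i) k = 0"
  "fps_nth (row_poly i) i = (if i = 0 then 2 else 1)"
proof -
  have "(\<forall>k>i. fps_nth (row_poly i) k = 0) \<and> fps_nth (row_poly i) i = (if i = 0 then 2 else 1)"
  proof (induction i rule: row_poly.induct)
    case (3 i)
    thus ?case by (auto simp: distrib_right numeral_fps_const)
  qed (auto simp: numeral_fps_const fps_X_def)
  thus "k > i \<Longrightarrow> fps_nth (row_poly i) k = 0" "fps_nth (row_poly i) i = (if i = 0 then 2 else 1)"
    by auto
qed

lemma w_quot_shift:
  "(fps_X + 3) oo (fps_X * w_quot) = (1 - fps_X) + 2 * inverse (1 - fps_X)"
proof -
  define u v :: "real fps" where "u = 1 - fps_X" and "v = inverse u"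
  have uv: "u * v = 1" unfolding v_def u_def by (rule inverse_mult_eq_1') simp
  have X: "fps_X = 1 - u" by (simp add: u_def)
  have "(fps_X + 3) oo (fps_X * w_quot) = (1 - u) * ((1 + (1 - u)) * v) + 3"
    by (simp add: numeral_fps_const fps_compose_add_distrib w_quot_def u_def v_def)
  \<comment> \<open>A polynomial identity in independent \<open>u\<close> and \<open>v\<close>; the
    last summand is a multiple of \<open>u * v - 1\<close>, hence zero.\<close>
  also have "\<dots> = u + 2 * v + (u * v - 1) * (u - 3)"
    by (simp add: algebra_simps)
  finally show ?thesis unfolding uv by (simp add: u_def v_def)
qed

lemma row_poly_compose:
  "row_poly i oo (fps_X * w_quot) = 2 ^ i * inverse (1 - fps_X) ^ i + (1 - fps_X) ^ i"
proof (induction i rule: row_poly.induct)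
  case 1
  show ?case by (simp add: numeral_fps_const)
next
  case 2
  show ?case by (simp add: w_quot_shift)
next
  case (3 i)
  define u v :: "real fps" where "u = 1 - fps_X" and "v = inverse u"
  have uv: "u * v = 1" unfolding v_def u_def by (rule inverse_mult_eq_1') simp
  have "row_poly (Suc (Suc i)) oo (fps_X * w_quot)
      = (u + 2 * v) * (2 ^ Suc i * v ^ Suc i + u ^ Suc i) - 2 * (2 ^ i * v ^ i + u ^ i)"
  proof -
    have "fps_nth (fps_X * w_quot) 0 = 0" by simp
    moreover have "(2 :: real fps) oo (fps_X * w_quot) = 2" by (simp add: numeral_fps_const)
    ultimately show ?thesis
      unfolding row_poly.simps
      by (simp only: fps_compose_sub_distrib fps_compose_mult_distrib w_quot_shift 3 u_def v_def)
  qed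
  also have "\<dots> = 2 ^ Suc (Suc i) * v ^ Suc (Suc i) + u ^ Suc (Suc i)"
  proof -
    have "(u + 2 * v) * (2 * a * (v * b) + u * c) - 2 * (a * b + c)
        = 4 * a * (v * v * b) + u * u * c + 2 * (u * v - 1) * (a * b + c)" for a b c
      by (simp add: algebra_simps)
    from this[of "2 ^ i" "v ^ i" "u ^ i"] show ?thesis by (simp add: uv)
  qed
  finally show ?case by (simp add: u_def v_def)
qed

text \<open>The two terms of \<open>row_poly_compose\<close> give the two binomials; odd
  \<open>m\<close> produces the minus sign, since \<open>(1 - z)^(i-1)\<close> has coefficient
  \<open>(-1)^m\<close> times the binomial.\<close>

lemma matrix_entry_eq_fps_nth:
  assumes "odd m"
  shows "fps_nth (inverse (1 - fps_X) * (row_poly i oo (fps_X * w_quot))) m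
       = 2 ^ i * (real (i + m) gchoose m) - ((real i - 1) gchoose m)"
proof -
  have v: "inverse (1 - fps_X) ^ Suc i = Abs_fps (\<lambda>k. real ((i + k) choose k))"
    using one_minus_const_fps_X_neg_power'[of "Suc i" "1::real"]
    by (simp add: fps_inverse_power del: power_Suc)
  have u: "fps_nth (inverse (1 - fps_X) * (1 - fps_X) ^ i) m = - ((real i - 1) gchoose m)"
  proof (cases i)
    \<comment> \<open>Here the exponent \<open>i - 1\<close> is negative: the series is geometric
      and its coefficient 1 must match \<open>-((-1) gchoose m)\<close>.\<close>
    case 0
    thus ?thesis using assms
      by (simp add: fps_inverse_one_minus_fps_X gbinomial_minus flip: binomial_gbinomial)
  next
    case (Suc k)
    have "inverse (1 - fps_X :: real fps) * (1 - fps_X) ^ i = (1 - fps_X) ^ k"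
      by (simp add: Suc inverse_mult_eq_1 flip: mult.assoc)
    also have "\<dots> = fps_binomial (of_nat k) oo (- fps_X)"
      using one_minus_const_fps_X_power[of "1::real" k] by simp
    finally show ?thesis using assms by (simp add: fps_compose_uminus' Suc)
  qed
  have "inverse (1 - fps_X) * (row_poly i oo (fps_X * w_quot))
      = fps_const (2 ^ i) * inverse (1 - fps_X) ^ Suc i + inverse (1 - fps_X) * (1 - fps_X) ^ i"
    unfolding row_poly_compose
    by (simp add: algebra_simps numeral_fps_const fps_const_power)
  thus ?thesis unfolding v by (simp add: u binomial_gbinomial)
qed

lemma fps_deriv_X_w_quot:
  "fps_deriv (fps_X * w_quot) = (1 + 2 * fps_X - fps_X ^ 2) * inverse (1 - fps_X) ^ 2"
proof -
  define v :: "real fps" where "v = inverse (1 - fps_X)"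
  have uv: "(1 - fps_X) * v = 1" unfolding v_def by (rule inverse_mult_eq_1') simp
  have dv: "fps_deriv v = v ^ 2" unfolding v_def by (subst fps_inverse_deriv) simp_all
  have "fps_deriv (fps_X * w_quot) = (1 + 2 * fps_X) * v + fps_X * (1 + fps_X) * v ^ 2"
    by (simp add: w_quot_def dv algebra_simps flip: v_def)
  also have "\<dots> = (1 + 2 * fps_X - fps_X ^ 2) * v ^ 2 + (1 + 2 * fps_X) * v * (1 - (1 - fps_X) * v)"
    by (simp add: algebra_simps power2_eq_square)
  finally show ?thesis unfolding uv by (simp add: v_def)
qed

section \<open>Column operations\<close>

text \<open>\<open>col_series m\<close> at \<open>z\<^sup>2\<close> is the even series of the header without its factor \<open>z\<^bsup>-m-1\<^esup>\<close>;
  there, \<open>1 - 6 z\<^sup>2 + z\<^sup>4\<close> is, up to powers of \<open>1 - z\<close>, the product of \<open>dw/dz\<close> and \<open>1 - w\<close>.\<close>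
definition col_series :: "nat \<Rightarrow> real fps" where
  "col_series m = inverse (1 - fps_X) ^ Suc m * (1 - 6 * fps_X + fps_X ^ 2) * (1 + fps_X) ^ (2 * m)"

text \<open>Both sides factor through \<open>1 + w = (1 + z^2)/(1 - z)\<close>,
  \<open>1 - w = (1 - 2z - z^2)/(1 - z)\<close> and \<open>dw/dz = (1 + 2z - z^2)/(1 - z)^2\<close>.
  The last two numerators multiply to the even polynomial \<open>1 - 6z^2 + z^4\<close>.\<close>

lemma col_series_compose:
  "inverse (1 - fps_X) * (col_series m oo fps_X ^ 2)
   = (((1 - fps_X) * (1 + fps_X) ^ (2 * m)) oo (fps_X * w_quot))
     * (fps_deriv (fps_X * w_quot) * inverse w_quot ^ Suc m)"
proof -
  define X u v u' v' :: "real fps"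
    where "X = fps_X" and "u = 1 - X" and "v = inverse u" and "u' = 1 + X" and "v' = inverse u'"
  have uv: "u * v = 1" "u' * v' = 1"
    unfolding v_def u_def v'_def u'_def X_def by (rule inverse_mult_eq_1', simp)+
  have w: "w_quot = u' * v" by (simp add: w_quot_def u'_def v_def u_def X_def)
  have iw: "inverse w_quot = v' * u"
    unfolding w v_def v'_def by (subst fps_inverse_mult) (simp add: u_def X_def)
  have w0: "fps_nth (X * w_quot) 0 = 0" by (simp add: X_def)
  have Xw: "X oo (X * w_quot) = X * w_quot" by (simp add: X_def)
  have plus: "(1 + X) oo (X * w_quot) = (1 + X ^ 2) * v"
  proof -
    have "(1 + X) oo (X * w_quot) = 1 + X * (u' * v)"
      by (simp add: fps_compose_add_distrib Xw) (simp add: w)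
    also have "\<dots> = (1 + X ^ 2) * v + (1 - u * v)"
      by (simp add: u_def u'_def algebra_simps power2_eq_square)
    finally show ?thesis by (simp add: uv)
  qed
  have minus: "(1 - X) oo (X * w_quot) = (1 - 2 * X - X ^ 2) * v"
  proof -
    have "(1 - X) oo (X * w_quot) = 1 - X * (u' * v)"
      by (simp add: fps_compose_sub_distrib Xw) (simp add: w)
    also have "\<dots> = (1 - 2 * X - X ^ 2) * v + (1 - u * v)"
      by (simp add: u_def u'_def algebra_simps power2_eq_square)
    finally show ?thesis by (simp add: uv)
  qed
  have dw: "fps_deriv (X * w_quot) = (1 + 2 * X - X ^ 2) * v ^ 2"
    by (simp only: X_def v_def u_def fps_deriv_X_w_quot)
  have X2: "fps_nth (X ^ 2) 0 = 0" by (simp add: X_def)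
  have XX: "X oo X ^ 2 = X ^ 2" by (simp add: X_def)
  have "(6 :: real fps) oo X ^ 2 = 6" by (simp add: numeral_fps_const)
  hence "(1 - 6 * X + X ^ 2) oo X ^ 2 = 1 - 6 * X ^ 2 + (X ^ 2) ^ 2"
    using X2 by (simp only: fps_compose_add_distrib fps_compose_sub_distrib fps_compose_mult_distrib
        XX fps_compose_1 flip: fps_compose_power[OF X2])
  also have "\<dots> = (1 - 2 * X - X ^ 2) * (1 + 2 * X - X ^ 2)"
    by (simp only: algebra_simps power2_eq_square) simp
  finally have c1: "(1 - 6 * X + X ^ 2) oo X ^ 2 = (1 - 2 * X - X ^ 2) * (1 + 2 * X - X ^ 2)" .
  have c2: "(1 + X) oo X ^ 2 = 1 + X ^ 2"
    by (simp only: fps_compose_add_distrib XX fps_compose_1)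
  have c3: "(1 - X) oo X ^ 2 = u * u'"
    by (simp only: fps_compose_sub_distrib XX fps_compose_1 u_def u'_def)
       (simp add: algebra_simps power2_eq_square)
  have "inverse (1 - X) oo X ^ 2 = inverse ((1 - X) oo X ^ 2)"
    by (rule fps_inverse_compose[OF X2]) (simp add: X_def)
  hence iuu: "inverse (1 - X) oo X ^ 2 = v * v'"
    by (simp only: c3 fps_inverse_mult v_def v'_def)
  have "v * (col_series m oo X ^ 2)
      = v * ((v * v') ^ Suc m * ((1 - 2 * X - X ^ 2) * (1 + 2 * X - X ^ 2)) * (1 + X ^ 2) ^ (2 * m))"
    unfolding col_series_def X_def[symmetric]
    by (simp only: fps_compose_mult_distrib[OF X2] c1 c2 iuu flip: fps_compose_power[OF X2])
  also have "\<dots> = ((1 - 2 * X - X ^ 2) * v * ((1 + X ^ 2) * v) ^ (2 * m))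
       * ((1 + 2 * X - X ^ 2) * v ^ 2 * (v' * u) ^ Suc m)"
  proof -
    \<comment> \<open>Of the \<open>2m + 3\<close> factors \<open>v\<close> on the right,
      \<open>m + 1\<close> cancel against \<open>u\<close>.\<close>
    have "v ^ Suc (Suc m) = v * v ^ (2 * m) * v ^ 2 * u ^ Suc m"
    proof -
      have "v * v ^ (2 * m) * v ^ 2 = v ^ Suc (Suc m) * v ^ Suc m"
        unfolding mult_2 power_add power2_eq_square power_Suc by (simp only: ac_simps)
      hence "v * v ^ (2 * m) * v ^ 2 * u ^ Suc m = v ^ Suc (Suc m) * (u * v) ^ Suc m"
        by (simp only: power_mult_distrib ac_simps)
      thus ?thesis by (simp only: uv power_one mult_1_right)
    qed
    hence *: "v * v ^ Suc m = v * v ^ (2 * m) * v ^ 2 * u ^ Suc m" by (simp only: power_Suc)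
    have "v * ((v * v') ^ Suc m * (a * b) * c ^ (2 * m))
        = a * v * (c * v) ^ (2 * m) * (b * v ^ 2 * (v' * u) ^ Suc m)" for a b c
    proof -
      have "v * ((v * v') ^ Suc m * (a * b) * c ^ (2 * m))
          = (v * v ^ Suc m) * (v' ^ Suc m * a * b * c ^ (2 * m))"
        by (simp only: power_mult_distrib ac_simps)
      also have "\<dots> = a * v * (c * v) ^ (2 * m) * (b * v ^ 2 * (v' * u) ^ Suc m)"
        unfolding * by (simp only: power_mult_distrib ac_simps)
      finally show ?thesis .
    qed
    thus ?thesis .
  qed
  also have "\<dots> = (((1 - X) * (1 + X) ^ (2 * m)) oo (X * w_quot))
     * (fps_deriv (X * w_quot) * inverse w_quot ^ Suc m)"
    by (simp only: fps_compose_mult_distrib[OF w0] plus minus iw dw flip: fps_compose_power[OF w0])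
  finally show ?thesis by (simp add: X_def v_def u_def)
qed

section \<open>Determinants of matrices given by entry functions\<close>

lemma det_mat_mult:
  fixes f g :: "nat \<Rightarrow> nat \<Rightarrow> 'a::comm_ring_1"
  shows "det (mat n n (\<lambda>(i, j). \<Sum>k<n. f i k * g k j))
       = det (mat n n (\<lambda>(i, j). f i j)) * det (mat n n (\<lambda>(i, j). g i j))"
proof -
  have "mat n n (\<lambda>(i, j). \<Sum>k<n. f i k * g k j)
      = mat n n (\<lambda>(i, j). f i j) * mat n n (\<lambda>(i, j). g i j)"
    by (rule eq_matI) (auto simp: scalar_prod_def lessThan_atLeast0)
  thus ?thesis by (simp add: det_mult[of _ n])
qed

lemma det_mat_upper_triangular:
  fixes f :: "nat \<Rightarrow> nat \<Rightarrow> 'a::comm_ring_1"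
  assumes "\<And>i j. j < i \<Longrightarrow> i < n \<Longrightarrow> f i j = 0"
  shows "det (mat n n (\<lambda>(i, j). f i j)) = (\<Prod>i<n. f i i)"
  using assms
  by (subst det_upper_triangular[of _ n])
     (auto simp: upper_triangular_def prod_list_diag_prod lessThan_atLeast0)

lemma det_mat_lower_triangular:
  fixes f :: "nat \<Rightarrow> nat \<Rightarrow> 'a::comm_ring_1"
  assumes "\<And>i j. i < j \<Longrightarrow> j < n \<Longrightarrow> f i j = 0"
  shows "det (mat n n (\<lambda>(i, j). f i j)) = (\<Prod>i<n. f i i)"
  using assms
  by (subst det_lower_triangular[of n])
     (auto simp: prod_list_diag_prod lessThan_atLeast0)

lemma det_mat_scale:
  fixes r c :: "nat \<Rightarrow> 'a::comm_ring_1"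
  shows "det (mat n n (\<lambda>(i, j). r i * c j * f i j))
       = (\<Prod>i<n. r i) * (\<Prod>j<n. c j) * det (mat n n (\<lambda>(i, j). f i j))"
proof -
  have *: "(\<Prod>i=0..<n. mat n n (\<lambda>(i, j). r i * c j * f i j) $$ (i, p i))
      = (\<Prod>i<n. r i) * (\<Prod>j<n. c j) * (\<Prod>i=0..<n. mat n n (\<lambda>(i, j). f i j) $$ (i, p i))"
    if p: "p permutes {0..<n}" for p
  proof -
    have pn: "p i < n" if "i < n" for i using permutes_in_image[OF p, of i] that by simp
    have "(\<Prod>i=0..<n. c (p i)) = (\<Prod>j=0..<n. c j)"
      using prod.permute[OF p, of c] by (simp add: o_def)
    thus ?thesis by (simp add: pn prod.distrib lessThan_atLeast0)
  qed
  show ?thesis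
    unfolding det_def'[of "mat n n _", OF mat_carrier] sum_distrib_left
    by (intro sum.cong refl) (simp only: mem_Collect_eq * mult.left_commute)
qed

text \<open>The matrix is a square coefficient matrix times a Vandermonde matrix, and scaling the
  points multiplies row \<open>d\<close> of the latter by \<open>c ^ d\<close>.\<close>

lemma det_mat_poly_scale:
  fixes p :: "nat \<Rightarrow> 'a::comm_ring_1 poly"
  assumes "\<And>k. k < n \<Longrightarrow> degree (p k) < n"
  shows "det (mat n n (\<lambda>(k, j). poly (p k) (c * x j)))
       = c ^ (\<Sum>d<n. d) * det (mat n n (\<lambda>(k, j). poly (p k) (x j)))"
proof -
  have poly: "poly (p k) y = (\<Sum>d<n. coeff (p k) d * y ^ d)" if "k < n" for k y
    unfolding poly_altdef using assms[OF that]
    by (intro sum.mono_neutral_left) (auto simp: coeff_eq_0)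
  \<comment> \<open>The trivial column factor 1 matches the shape of
    \<open>det_mat_scale\<close>.\<close>
  have "mat n n (\<lambda>(k, j). poly (p k) (c * x j))
      = mat n n (\<lambda>(k, j). \<Sum>d<n. coeff (p k) d * (c ^ d * 1 * x j ^ d))"
    by (rule eq_matI) (auto simp: poly power_mult_distrib)
  hence "det (mat n n (\<lambda>(k, j). poly (p k) (c * x j)))
      = det (mat n n (\<lambda>(k, d). coeff (p k) d)) * (c ^ (\<Sum>d<n. d) * det (mat n n (\<lambda>(d, j). x j ^ d)))"
    by (simp only: det_mat_mult det_mat_scale power_sum) simp
  also have "\<dots> = c ^ (\<Sum>d<n. d) * det (mat n n (\<lambda>(k, j). \<Sum>d<n. coeff (p k) d * x j ^ d))"
    by (simp only: det_mat_mult ac_simps)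
  also have "mat n n (\<lambda>(k, j). \<Sum>d<n. coeff (p k) d * x j ^ d) = mat n n (\<lambda>(k, j). poly (p k) (x j))"
    by (rule eq_matI) (auto simp: poly)
  finally show ?thesis .
qed

section \<open>The ballot number determinant\<close>

text \<open>\<open>fact_poly n k\<close> at \<open>y = m + 1\<close> collects the \<open>k\<close>-dependent factorials of a ballot number; it
  vanishes at \<open>y = 1, \<dots>, k\<close>, so its values at consecutive integers form a triangular matrix.\<close>
definition fact_poly :: "nat \<Rightarrow> nat \<Rightarrow> real poly" where
  "fact_poly n k = (\<Prod>t=1..k. [:- real t, 1:]) * (\<Prod>t=Suc k..<n. [:real t, 1:])"

lemma degree_fact_poly:
  assumes "k < n"
  shows "degree (fact_poly n k) < n"
proof -
  have "degree (fact_poly n k) = k + (n - Suc k)"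
    by (simp add: fact_poly_def degree_mult_eq degree_prod_eq_sum_degree)
  thus ?thesis using assms by simp
qed

lemma poly_fact_poly:
  assumes "k < n"
  shows "poly (fact_poly n k) (real (Suc m))
       = (if k \<le> m then fact m * fact (m + n) / (fact (m - k) * fact (m + k + 1)) else 0)"
proof -
  have 1: "(\<Prod>t=1..k. real (Suc m) - real t) = (if k \<le> m then fact m / fact (m - k) else 0)"
  proof (induction k)
    case (Suc k)
    show ?case
    proof (cases "Suc k \<le> m")
      case True
      hence "m - k = Suc (m - Suc k)" by simp
      hence fact: "fact (m - k) = (real (Suc m) - real (Suc k)) * fact (m - Suc k)"
        using True by (simp add: of_nat_diff)
      have "real (Suc m) - real (Suc k) \<noteq> 0" using True by simp
      thus ?thesis using True Suc.IH fact by (simp del: of_nat_Suc)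
    next
      case False
      hence "(\<Prod>t=1..Suc k. real (Suc m) - real t) = 0"
        by (intro prod_zero) (auto intro!: bexI[of _ "Suc m"])
      thus ?thesis using False by simp
    qed
  qed simp
  have "(\<Prod>t=Suc k..<k + Suc d. real (Suc m) + real t) = fact (m + k + Suc d) / fact (m + k + 1)" for d
  proof (induction d)
    case (Suc d)
    have "fact (m + k + Suc (Suc d)) = (real (Suc m) + real (k + Suc d)) * fact (m + k + Suc d)"
      by (simp add: algebra_simps)
    moreover have "(\<Prod>t=Suc k..<k + Suc (Suc d). real (Suc m) + real t)
        = (\<Prod>t=Suc k..<k + Suc d. real (Suc m) + real t) * (real (Suc m) + real (k + Suc d))"
      by simp
    ultimately show ?case by (simp only: Suc.IH times_divide_eq_left times_divide_eq_right mult.commute)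
  qed simp
  from this[of "n - Suc k"] have 2: "(\<Prod>t=Suc k..<n. real (Suc m) + real t) = fact (m + n) / fact (m + k + 1)"
    using assms by simp
  have "poly (fact_poly n k) (real (Suc m))
     = (\<Prod>t=1..k. real (Suc m) - real t) * (\<Prod>t=Suc k..<n. real (Suc m) + real t)"
    by (simp add: fact_poly_def poly_prod algebra_simps)
  thus ?thesis unfolding 1 2 by simp
qed

text \<open>The coefficient is a difference of neighbouring binomials; over the denominator
  \<open>(m-k)! (m+k+1)!\<close> the numerators leave
  \<open>(m+k+1) - (m-k) = 2k + 1\<close>.\<close>

lemma ballot_coefficient:
  assumes "k \<le> m"
  shows "fps_nth ((1 - fps_X) * (1 + fps_X) ^ (2 * m) :: real fps) (m - k)
       = real (2 * k + 1) * fact (2 * m) / (fact (m - k) * fact (m + k + 1))"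
proof -
  obtain e where m: "m = k + e" using assms le_Suc_ex by blast
  have coeff: "fps_nth ((1 + fps_X) ^ N) i = real (N choose i)" for N i
    by (simp add: binomial_gbinomial flip: fps_binomial_of_nat)
  have "fps_nth ((1 - fps_X) * (1 + fps_X) ^ (2 * m) :: real fps) e
      = real (2 * m choose e) - (if e = 0 then 0 else real (2 * m choose (e - 1)))"
    by (simp add: left_diff_distrib coeff)
  also have "\<dots> = real (2 * k + 1) * fact (2 * m) / (fact e * fact (m + k + 1))"
  proof (cases e)
    case 0
    have "real (2 * k + 1) * fact (2 * k) = fact (Suc (2 * k))" by simp
    thus ?thesis by (simp add: m 0 del: fact_Suc of_nat_Suc flip: mult_2)
  next
    case (Suc d)
    have 1: "real (2 * m choose e) = fact (2 * m) / (fact e * fact (2 * k + e))"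
      by (subst binomial_fact) (auto simp: m mult_2 add.assoc)
    have d: "d \<le> 2 * m" "2 * m - d = Suc (2 * k + e)" using Suc m by simp_all
    have 2: "real (2 * m choose d) = fact (2 * m) / (fact d * fact (Suc (2 * k + e)))"
      using binomial_fact[OF d(1), where 'a = real] by (simp only: d(2))
    have "real (2 * m choose d) = real e * fact (2 * m) / (fact e * fact (Suc (2 * k + e)))"
      unfolding 2 by (simp add: Suc del: of_nat_Suc)
    moreover have "real (2 * m choose e)
        = real (Suc (2 * k + e)) * fact (2 * m) / (fact e * fact (Suc (2 * k + e)))"
      unfolding 1 by (simp del: of_nat_Suc)
    ultimately have "real (2 * m choose e) - real (2 * m choose d)
        = (real (Suc (2 * k + e)) - real e) * fact (2 * m) / (fact e * fact (Suc (2 * k + e)))"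
      by (simp only: diff_divide_distrib left_diff_distrib)
    moreover have "real (Suc (2 * k + e)) - real e = real (2 * k + 1)" by simp
    moreover have "m + k + 1 = Suc (2 * k + e)" by (simp add: m)
    moreover have "(if e = 0 then 0 else real (2 * m choose (e - 1))) = real (2 * m choose d)"
      by (simp add: Suc)
    ultimately show ?thesis by (simp only:)
  qed
  finally show ?thesis by (simp add: m)
qed

text \<open>The factorials of \<open>k\<close> and \<open>k + n\<close> together run through all
  factorials below \<open>2n\<close>. Pairing them as \<open>(2k)! (2k+1)!\<close>, the factor
  \<open>2k + 1\<close> completes each pair to a square.\<close>

lemma prod_odd_facts:
  "(\<Prod>k<n. real (2 * k + 1) * (fact k * fact (k + n))) = (\<Prod>k<n. fact (2 * k + 1) ^ 2)"
proof -
  have split: "(\<Prod>k<n + d. fact k :: real) = (\<Prod>k<n. fact k) * (\<Prod>k<d. fact (k + n))" for d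
    by (induction d) (simp_all add: ac_simps)
  have pair: "(\<Prod>k<2 * n. fact k :: real) = (\<Prod>k<n. fact (2 * k) * fact (2 * k + 1))"
    by (induction n) (simp_all add: ac_simps)
  have "(\<Prod>k<n. real (2 * k + 1) * (fact k * fact (k + n)))
      = (\<Prod>k<n. real (2 * k + 1)) * (\<Prod>k<2 * n. fact k)"
    using split[of n] by (simp only: prod.distrib mult_2)
  also have "\<dots> = (\<Prod>k<n. fact (2 * k + 1) ^ 2)"
    unfolding pair prod.distrib[symmetric]
    by (intro prod.cong refl) (simp add: power2_eq_square)
  finally show ?thesis .
qed

lemma det_ballot:
  "det (mat n n (\<lambda>(k, j). if k \<le> 2 * j + 1
       then fps_nth ((1 - fps_X) * (1 + fps_X) ^ (2 * (2 * j + 1)) :: real fps) (2 * j + 1 - k) else 0))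
   = (\<Prod>j<n. 2 ^ j * fact (4 * j + 2) / fact (n + 2 * j + 1))" (is "det ?N = _")
proof -
  define c :: "nat \<Rightarrow> real"
    where "c j = fact (4 * j + 2) / (fact (2 * j + 1) * fact (n + 2 * j + 1))" for j
  have entry: "(if k \<le> m then fps_nth ((1 - fps_X) * (1 + fps_X) ^ (2 * m) :: real fps) (m - k) else 0)
      = real (2 * k + 1) * (fact (2 * m) / (fact m * fact (m + n))) * poly (fact_poly n k) (real (Suc m))"
    if "k < n" for k m
    by (cases "k \<le> m")
       (simp_all add: ballot_coefficient poly_fact_poly[OF that] del: of_nat_Suc fact_Suc)
  have "?N = mat n n (\<lambda>(k, j). real (2 * k + 1) * c j * poly (fact_poly n k) (2 * real (Suc j)))"
  proof (rule eq_matI, goal_cases)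
    case (1 k j)
    \<comment> \<open>For \<open>m = 2j + 1\<close> the evaluation point \<open>m + 1\<close> is
      twice \<open>j + 1\<close>, which is what the rescaling exploits.\<close>
    have "4 * j + 2 = 2 * (2 * j + 1)" "n + 2 * j + 1 = 2 * j + 1 + n"
      "2 * real (Suc j) = real (Suc (2 * j + 1))" by simp_all
    moreover have "k < n" "j < n" using 1 by simp_all
    moreover note entry[OF this(1), of "2 * j + 1"]
    ultimately show ?case by (simp only: index_mat prod.case c_def)
  qed simp_all
  hence "det ?N = (\<Prod>k<n. real (2 * k + 1)) * (\<Prod>j<n. c j)
      * (2 ^ (\<Sum>d<n. d) * det (mat n n (\<lambda>(k, j). poly (fact_poly n k) (real (Suc j)))))"
    by (simp only: det_mat_scale det_mat_poly_scale degree_fact_poly)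
  also have "det (mat n n (\<lambda>(k, j). poly (fact_poly n k) (real (Suc j))))
      = (\<Prod>k<n. poly (fact_poly n k) (real (Suc k)))"
    by (rule det_mat_upper_triangular) (simp add: poly_fact_poly del: of_nat_Suc)
  also have "\<dots> = (\<Prod>k<n. fact k * fact (k + n) / fact (2 * k + 1))"
    by (intro prod.cong refl) (simp add: poly_fact_poly mult_2 del: of_nat_Suc)
  also have "(\<Prod>k<n. real (2 * k + 1)) * (\<Prod>j<n. c j)
      * (2 ^ (\<Sum>d<n. d) * (\<Prod>k<n. fact k * fact (k + n) / fact (2 * k + 1)))
    = (\<Prod>k<n. real (2 * k + 1) * (fact k * fact (k + n)))
      * (\<Prod>j<n. c j * 2 ^ j / fact (2 * j + 1))"
    by (simp add: prod.distrib prod_dividef power_sum del: fact_Suc)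
  \<comment> \<open>The squares cancel the two denominators \<open>(2j+1)!\<close>, one from
    \<open>c j\<close> and one from the diagonal.\<close>
  also have "\<dots> = (\<Prod>j<n. 2 ^ j * fact (4 * j + 2) / fact (n + 2 * j + 1))"
    unfolding prod_odd_facts prod.distrib[symmetric]
    by (intro prod.cong refl) (simp add: c_def power2_eq_square del: fact_Suc)
  finally show ?thesis .
qed

section \<open>Assembling the matrix identity\<close>

text \<open>An even series pairs odd coefficients only with odd ones, so multiplying by it acts as
  an upper triangular column operation.\<close>

lemma fps_nth_mult_compose_X2:
  fixes f c :: "'a::comm_ring_1 fps"
  assumes "j < n"
  shows "fps_nth (f * (c oo fps_X ^ 2)) (2 * j + 1)
       = (\<Sum>l<n. fps_nth f (2 * l + 1) * (if l \<le> j then fps_nth c (j - l) else 0))"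
proof -
  let ?g = "\<lambda>s. fps_nth f s * fps_nth (c oo fps_X ^ 2) (2 * j + 1 - s)"
  have "fps_nth (f * (c oo fps_X ^ 2)) (2 * j + 1) = sum ?g {0..2 * j + 1}"
    by (rule fps_mult_nth)
  also have "\<dots> = sum ?g ((\<lambda>l. 2 * l + 1) ` {..j})"
  proof (rule sum.mono_neutral_right)
    show "\<forall>s\<in>{0..2 * j + 1} - (\<lambda>l. 2 * l + 1) ` {..j}. ?g s = 0"
    proof
      fix s assume s: "s \<in> {0..2 * j + 1} - (\<lambda>l. 2 * l + 1) ` {..j}"
      have "even s"
      proof (rule ccontr)
        assume "odd s"
        then obtain l where "s = 2 * l + 1" by (rule oddE)
        with s show False by auto
      qed
      hence "odd (2 * j + 1 - s)" using s by simp
      thus "?g s = 0" by (simp add: fps_nth_compose_X_power)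
    qed
  qed auto
  also have "\<dots> = (\<Sum>l\<le>j. ?g (2 * l + 1))"
    by (subst sum.reindex) (auto simp: inj_on_def)
  also have "\<dots> = (\<Sum>l\<le>j. fps_nth f (2 * l + 1) * fps_nth c (j - l))"
  proof (rule sum.cong[OF refl])
    fix l assume "l \<in> {..j}"
    hence "2 * j + 1 - (2 * l + 1) = 2 * (j - l)" by simp
    thus "?g (2 * l + 1) = fps_nth f (2 * l + 1) * fps_nth c (j - l)"
      by (simp only: fps_nth_compose_X_power) simp
  qed
  also have "\<dots> = (\<Sum>l<n. fps_nth f (2 * l + 1) * (if l \<le> j then fps_nth c (j - l) else 0))"
    using assms by (intro sum.mono_neutral_cong_left) auto
  finally show ?thesis .
qed

text \<open>By \<open>col_series_compose\<close> the left side is a residue of a series in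
  \<open>w\<close> against \<open>w^(-m-1) dw\<close>; invariance of the residue replaces
  \<open>w\<close> by the plain variable.\<close>

lemma row_column_pairing:
  "fps_nth (inverse (1 - fps_X) * (row_poly i oo (fps_X * w_quot)) * (col_series m oo fps_X ^ 2)) m
   = fps_nth (row_poly i * ((1 - fps_X) * (1 + fps_X) ^ (2 * m))) m"
proof -
  let ?w = "fps_X * w_quot" and ?B = "(1 - fps_X) * (1 + fps_X) ^ (2 * m) :: real fps"
  have w0: "fps_nth ?w 0 = 0" by simp
  have "inverse (1 - fps_X) * (row_poly i oo ?w) * (col_series m oo fps_X ^ 2)
      = (row_poly i oo ?w) * (inverse (1 - fps_X) * (col_series m oo fps_X ^ 2))"
    by (simp only: ac_simps)
  also have "\<dots> = ((row_poly i * ?B) oo ?w) * (fps_deriv ?w * inverse w_quot ^ Suc m)"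
    by (simp only: col_series_compose fps_compose_mult_distrib[OF w0, of "row_poly i"] mult.assoc)
  finally show ?thesis
    by (simp only:) (rule fps_nth_residue_compose, simp add: w_quot_def)
qed

theorem theorem4:
  fixes n :: nat
  assumes "n \<ge> 1"
  shows "det (mat n n (\<lambda>(i, j).
             2 ^ i * (real (i + 2 * j + 1) gchoose (2 * j + 1))
             - ((real i - 1) gchoose (2 * j + 1))))
         = 2 * (\<Prod>i = 1..n. 2 ^ (i - 1) * fact (4 * i - 2) / fact (n + 2 * i - 1))"
proof -
  define M where "M i j = 2 ^ i * (real (i + 2 * j + 1) gchoose (2 * j + 1))
      - ((real i - 1) gchoose (2 * j + 1))" for i j :: nat
  define C where "C l j = (if l \<le> j then fps_nth (col_series (2 * j + 1)) (j - l) else 0)" for l j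
  define L where "L i k = fps_nth (row_poly i) k" for i k
  define N where "N k j = (if k \<le> 2 * j + 1
       then fps_nth ((1 - fps_X) * (1 + fps_X) ^ (2 * (2 * j + 1)) :: real fps) (2 * j + 1 - k) else 0)"
    for k j :: nat
  \<comment> \<open>The core identity is \<open>M C = L N\<close>, with \<open>C\<close> and
    \<open>L\<close> triangular and \<open>N\<close> the ballot matrix.\<close>
  have "(\<Sum>l<n. M i l * C l j) = (\<Sum>k<n. L i k * N k j)" if "i < n" "j < n" for i j
  proof -
    have "M i l = fps_nth (inverse (1 - fps_X) * (row_poly i oo (fps_X * w_quot))) (2 * l + 1)" for l
      unfolding M_def by (subst matrix_entry_eq_fps_nth) (simp_all only: add.assoc, simp)
    hence "(\<Sum>l<n. M i l * C l j)
        = fps_nth (row_poly i * ((1 - fps_X) * (1 + fps_X) ^ (2 * (2 * j + 1)))) (2 * j + 1)"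
      unfolding C_def
      by (simp only: row_column_pairing flip: fps_nth_mult_compose_X2[OF that(2)])
    \<comment> \<open>The ranges \<open>k \<le> 2j + 1\<close> and \<open>k < n\<close> agree up to
      zero terms: \<open>row_poly i\<close> has degree at most \<open>i < n\<close>, and
      \<open>N\<close> is 0 past \<open>2j + 1\<close>.\<close>
    also have "\<dots> = (\<Sum>k<n. L i k * N k j)"
      unfolding fps_mult_nth[of "row_poly i"] using that(1)
      by (intro sum.mono_neutral_cong) (auto simp: L_def N_def row_poly_nth)
    finally show ?thesis .
  qed
  hence "mat n n (\<lambda>(i, j). \<Sum>l<n. M i l * C l j) = mat n n (\<lambda>(i, j). \<Sum>k<n. L i k * N k j)"
    by (intro eq_matI) auto
  hence "det (mat n n (\<lambda>(i, j). M i j)) * det (mat n n (\<lambda>(i, j). C i j))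
      = det (mat n n (\<lambda>(i, j). L i j)) * det (mat n n (\<lambda>(i, j). N i j))"
    by (simp only: flip: det_mat_mult)
  moreover have "det (mat n n (\<lambda>(i, j). C i j)) = 1"
    by (subst det_mat_upper_triangular) (simp_all add: C_def col_series_def fps_power_zeroth)
  \<comment> \<open>The hypothesis \<open>n \<ge> 1\<close> ensures that the diagonal entry 2 of row
    0 is present.\<close>
  moreover have "det (mat n n (\<lambda>(i, j). L i j)) = 2"
    using assms by (subst det_mat_lower_triangular) (simp_all add: L_def row_poly_nth)
  moreover have "det (mat n n (\<lambda>(i, j). N i j))
      = (\<Prod>i = 1..n. 2 ^ (i - 1) * fact (4 * i - 2) / fact (n + 2 * i - 1))"
    unfolding N_def det_ballot unfolding One_nat_def prod.atLeast1_atMost_eq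
    by (intro prod.cong refl) (simp del: fact_Suc)
  ultimately show ?thesis by (simp add: M_def)
qed

end
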